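(* Let $\mathrm{d}$ be the Euclidean metric on $\mathbb{R}^2$. Then $(\mathbb{R}^{1,1},\mathrm{d},\ll,\le,\tau^p)$ is a Lorentzian length space for every $p\in[1,\infty)$, and a Lorentzian pre-length space for $p=\infty$.
   Context: $\mathbb{R}^{1,1}$ is $\mathbb{R}^2$ with coordinates $x=(x_0,x_1)$ and the Minkowski relations: $x\ll y$ iff $y_0-x_0>|y_1-x_1|$, and $x\le y$ iff $y_0-x_0\ge|y_1-x_1|$. For $1\le p<\infty$, $\tau^p(x,y):=(|y_0-x_0|^p-|y_1-x_1|^p)^{1/p}$ if $y_0-x_0\ge|y_1-x_1|$, and $\tau^p(x,y):=0$ otherwise. $\tau^\infty$ is the pointwise limit as $p\to\infty$: $\tau^\infty(x,y)=y_0-x_0$ if $y_0-x_0>|y_1-x_1|$, and $0$ otherwise. A Lorentzian pre-length space $(X,\mathrm{d},\ll,\le,\tau)$ consists of a set $X$ with a metric $\mathrm{d}$, a reflexive and transitive relation $\le$, a transitive relation $\ll$ contained in $\le$, and a function $\tau:X\times X\to[0,\infty]$ that is lower semicontinuous with respect to $\mathrm{d}$, satisfies $\tau(x,z)\ge\tau(x,y)+\tau(y,z)$ for all $x\le y\le z$, satisfies $\tau(x,y)=0$ if $x\not\le y$, and satisfies $\tau(x,y)>0\Leftrightarrow x\ll y$. Write $x<y$ if $x\le y$ and $x\ne y$. A (future-directed) causal (timelike) curve is a non-constant, locally Lipschitz (w.r.t. $\mathrm{d}$) curve $\gamma:[\alpha,\beta]\to X$ with $\gamma(s)\le\gamma(t)$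 ($\gamma(s)\ll\gamma(t)$) for all $s<t$. Its $\tau$-length is $L_\tau(\gamma)=\inf\sum_i\tau(\gamma(t_i),\gamma(t_{i+1}))$ over all partitions of $[\alpha,\beta]$; its $\mathrm{d}$-length is the usual metric length. $I^+(y)=\{z:y\ll z\}$, $I^-(y)=\{z:z\ll y\}$. A Lorentzian pre-length space is a Lorentzian length space if: (1) it is locally causally closed: every point has a neighborhood $U$ such that if $p_n,q_n\in U$, $p_n\le q_n$, $p_n\to p\in\overline U$, $q_n\to q\in\overline U$, then $p\le q$; (2) it is causally path connected: if $x\ll y$ there is a timelike curve from $x$ to $y$, and if $x<y$ there is a causal curve from $x$ to $y$; (3) it is localizable: every $x\in X$ has an open neighborhood $\Omega_x$ such that (i) there is $C>0$ bounding the $\mathrm{d}$-length of all causal curves contained in $\Omega_x$; (ii) there is a continuous $\omega_x:\Omega_x\times\Omega_x\to[0,\infty)$ such that $\Omega_x$ with the restrictions of $\mathrm{d},\ll,\le$ and with $\omega_x$ is a Lorentzian pre-length space, and $I^\pm(y)\cap\Omega_x\ne\emptyset$ for all $y\in\Omega_x$; (iii) for all $p<q$ in $\Omega_x$ there is a causal curve $\gamma_{p,q}$ from $p$ to $q$ in $\Omega_x$ which has maximal $\tau$-length among all causal curves from $p$ to $q$ contained in $\Omega_x$ and satisfies $L_\tau(\gamma_{p,q})=\omega_x(p,q)\le\tau(p,q)$; (4) $\tau$ is intrinsic: $\tau(x,y)=\sup\{L_\tau(\gamma):\gamma\text{ a causal curve from }x\text{ to }y\}$ for all $x,y$, with the supremum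 set to $0$ if there is no such curve. *)

theory Defs
  imports "HOL-Analysis.Analysis"
begin

section \<open>Lorentzian pre-length spaces\<close>

text \<open>
  The metric space \<open>(X, d)\<close> is a value \<open>M :: 'a metric\<close>, so that the restriction of \<open>d\<close> to a
  subset is \<^const>\<open>submetric\<close>. Everything is relativised to \<^term>\<open>mspace M\<close>; in particular
  relations and time separation functions are restricted to a subset merely by passing to the
  submetric.
\<close>

definition lower_semicontinuous_map ::
    "'a topology \<Rightarrow> ('a \<Rightarrow> 'b::linorder) \<Rightarrow> bool" where
  "lower_semicontinuous_map T f \<longleftrightarrow> (\<forall>c. openin T {x \<in> topspace T. c < f x})"

locale lorentzian_pre_length_space =
  fixes M :: "'a metric"
    and chron :: "'a \<Rightarrow> 'a \<Rightarrow> bool"  (infix \<open>\<lless>\<close> 50)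
    and causal :: "'a \<Rightarrow> 'a \<Rightarrow> bool"  (infix \<open>\<preceq>\<close> 50)
    and \<tau> :: "'a \<Rightarrow> 'a \<Rightarrow> ennreal"
  assumes causal_refl: "x \<in> mspace M \<Longrightarrow> x \<preceq> x"
    and causal_trans:
      "\<lbrakk>x \<in> mspace M; y \<in> mspace M; z \<in> mspace M; x \<preceq> y; y \<preceq> z\<rbrakk> \<Longrightarrow> x \<preceq> z"
    and chron_trans:
      "\<lbrakk>x \<in> mspace M; y \<in> mspace M; z \<in> mspace M; x \<lless> y; y \<lless> z\<rbrakk> \<Longrightarrow> x \<lless> z"
    and chron_imp_causal: "\<lbrakk>x \<in> mspace M; y \<in> mspace M; x \<lless> y\<rbrakk> \<Longrightarrow> x \<preceq> y"
    and tau_lsc: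
      "lower_semicontinuous_map (prod_topology (mtopology_of M) (mtopology_of M)) (\<lambda>(x, y). \<tau> x y)"
    and tau_reverse_triangle:
      "\<lbrakk>x \<in> mspace M; y \<in> mspace M; z \<in> mspace M; x \<preceq> y; y \<preceq> z\<rbrakk> \<Longrightarrow> \<tau> x y + \<tau> y z \<le> \<tau> x z"
    and tau_eq_0: "\<lbrakk>x \<in> mspace M; y \<in> mspace M; \<not> x \<preceq> y\<rbrakk> \<Longrightarrow> \<tau> x y = 0"
    and tau_pos_iff: "\<lbrakk>x \<in> mspace M; y \<in> mspace M\<rbrakk> \<Longrightarrow> 0 < \<tau> x y \<longleftrightarrow> x \<lless> y"

section \<open>Curves and their lengths\<close>

definition locally_Lipschitz_curve :: "'a metric \<Rightarrow> real \<Rightarrow> real \<Rightarrow> (real \<Rightarrow> 'a) \<Rightarrow> bool" where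
  "locally_Lipschitz_curve M a b \<gamma> \<longleftrightarrow>
     (\<forall>t\<in>{a..b}. \<exists>U. openin (top_of_set {a..b}) U \<and> t \<in> U \<and>
        Lipschitz_continuous_map (submetric euclidean_metric U) M \<gamma>)"

text \<open>
  A curve \<open>\<gamma> : [a, b] \<rightarrow> X\<close> is a total function of which only the values on \<open>{a..b}\<close> matter.
  The relation \<open>R\<close> is \<open>\<le>\<close> for causal and \<open>\<lless>\<close> for timelike curves. Non-constancy forces \<open>a < b\<close>.
\<close>

definition directed_curve ::
    "'a metric \<Rightarrow> ('a \<Rightarrow> 'a \<Rightarrow> bool) \<Rightarrow> real \<Rightarrow> real \<Rightarrow> (real \<Rightarrow> 'a) \<Rightarrow> bool" where
  "directed_curve M R a b \<gamma> \<longleftrightarrow>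
     \<gamma> \<in> {a..b} \<rightarrow> mspace M \<and>
     \<not> \<gamma> constant_on {a..b} \<and>
     locally_Lipschitz_curve M a b \<gamma> \<and>
     (\<forall>s\<in>{a..b}. \<forall>t\<in>{a..b}. s < t \<longrightarrow> R (\<gamma> s) (\<gamma> t))"

definition directed_curve_from_to ::
    "'a metric \<Rightarrow> ('a \<Rightarrow> 'a \<Rightarrow> bool) \<Rightarrow> 'a \<Rightarrow> 'a \<Rightarrow> real \<Rightarrow> real \<Rightarrow> (real \<Rightarrow> 'a) \<Rightarrow> bool" where
  "directed_curve_from_to M R x y a b \<gamma> \<longleftrightarrow> directed_curve M R a b \<gamma> \<and> \<gamma> a = x \<and> \<gamma> b = y"

text \<open>Partitions \<open>a = t 0 < t 1 < \<dots> < t n = b\<close>; only the values of \<open>t\<close> on \<open>{..n}\<close> matter.\<close>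

definition partitions :: "real \<Rightarrow> real \<Rightarrow> (nat \<times> (nat \<Rightarrow> real)) set" where
  "partitions a b = {(n, t). t 0 = a \<and> t n = b \<and> (\<forall>i<n. t i < t (Suc i))}"

definition tau_length :: "('a \<Rightarrow> 'a \<Rightarrow> ennreal) \<Rightarrow> real \<Rightarrow> real \<Rightarrow> (real \<Rightarrow> 'a) \<Rightarrow> ennreal" where
  "tau_length \<tau> a b \<gamma> = (INF (n, t)\<in>partitions a b. \<Sum>i<n. \<tau> (\<gamma> (t i)) (\<gamma> (t (Suc i))))"

definition metric_length :: "'a metric \<Rightarrow> real \<Rightarrow> real \<Rightarrow> (real \<Rightarrow> 'a) \<Rightarrow> ennreal" where
  "metric_length M a b \<gamma> =
     (SUP (n, t)\<in>partitions a b. \<Sum>i<n. ennreal (mdist M (\<gamma> (t i)) (\<gamma> (t (Suc i)))))"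

section \<open>Lorentzian length spaces\<close>

definition locally_causally_closed :: "'a metric \<Rightarrow> ('a \<Rightarrow> 'a \<Rightarrow> bool) \<Rightarrow> bool" where
  "locally_causally_closed M causal \<longleftrightarrow>
     (\<forall>x\<in>mspace M. \<exists>U\<subseteq>mspace M.
        (\<exists>V. openin (mtopology_of M) V \<and> x \<in> V \<and> V \<subseteq> U) \<and>
        (\<forall>(p :: nat \<Rightarrow> 'a) q p' q'.
           (\<forall>n. p n \<in> U \<and> q n \<in> U \<and> causal (p n) (q n)) \<longrightarrow>
           limitin (mtopology_of M) p p' sequentially \<longrightarrow>
           limitin (mtopology_of M) q q' sequentially \<longrightarrow>
           p' \<in> mtopology_of M closure_of U \<longrightarrow>
           q' \<in> mtopology_of M closure_of U \<longrightarrow>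
           causal p' q'))"

definition causally_path_connected ::
    "'a metric \<Rightarrow> ('a \<Rightarrow> 'a \<Rightarrow> bool) \<Rightarrow> ('a \<Rightarrow> 'a \<Rightarrow> bool) \<Rightarrow> bool" where
  "causally_path_connected M chron causal \<longleftrightarrow>
     (\<forall>x\<in>mspace M. \<forall>y\<in>mspace M.
        (chron x y \<longrightarrow> (\<exists>a b \<gamma>. directed_curve_from_to M chron x y a b \<gamma>)) \<and>
        (causal x y \<and> x \<noteq> y \<longrightarrow> (\<exists>a b \<gamma>. directed_curve_from_to M causal x y a b \<gamma>)))"

definition localizing_neighbourhood ::
    "'a metric \<Rightarrow> ('a \<Rightarrow> 'a \<Rightarrow> bool) \<Rightarrow> ('a \<Rightarrow> 'a \<Rightarrow> bool) \<Rightarrow> ('a \<Rightarrow> 'a \<Rightarrow> ennreal)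
      \<Rightarrow> 'a set \<Rightarrow> ('a \<Rightarrow> 'a \<Rightarrow> real) \<Rightarrow> bool" where
  "localizing_neighbourhood M chron causal \<tau> \<Omega> \<omega> \<longleftrightarrow>
     (\<exists>C::real. C > 0 \<and> (\<forall>a b \<gamma>. directed_curve M causal a b \<gamma> \<and> \<gamma> ` {a..b} \<subseteq> \<Omega>
         \<longrightarrow> metric_length M a b \<gamma> \<le> ennreal C)) \<and>
     (\<forall>x\<in>\<Omega>. \<forall>y\<in>\<Omega>. 0 \<le> \<omega> x y) \<and>
     continuous_map
       (prod_topology (mtopology_of (submetric M \<Omega>)) (mtopology_of (submetric M \<Omega>)))
       euclideanreal (\<lambda>(x, y). \<omega> x y) \<and>
     lorentzian_pre_length_space (submetric M \<Omega>) chron causal (\<lambda>x y. ennreal (\<omega> x y)) \<and>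
     (\<forall>y\<in>\<Omega>. {z \<in> mspace M. chron y z} \<inter> \<Omega> \<noteq> {} \<and> {z \<in> mspace M. chron z y} \<inter> \<Omega> \<noteq> {}) \<and>
     (\<forall>p\<in>\<Omega>. \<forall>q\<in>\<Omega>. causal p q \<and> p \<noteq> q \<longrightarrow>
        (\<exists>a b \<gamma>. directed_curve_from_to M causal p q a b \<gamma> \<and> \<gamma> ` {a..b} \<subseteq> \<Omega> \<and>
           (\<forall>a' b' \<sigma>. directed_curve_from_to M causal p q a' b' \<sigma> \<and> \<sigma> ` {a'..b'} \<subseteq> \<Omega>
              \<longrightarrow> tau_length \<tau> a' b' \<sigma> \<le> tau_length \<tau> a b \<gamma>) \<and>
           tau_length \<tau> a b \<gamma> = ennreal (\<omega> p q) \<and> ennreal (\<omega> p q) \<le> \<tau> p q))"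

definition localizable ::
    "'a metric \<Rightarrow> ('a \<Rightarrow> 'a \<Rightarrow> bool) \<Rightarrow> ('a \<Rightarrow> 'a \<Rightarrow> bool) \<Rightarrow> ('a \<Rightarrow> 'a \<Rightarrow> ennreal) \<Rightarrow> bool" where
  "localizable M chron causal \<tau> \<longleftrightarrow>
     (\<forall>x\<in>mspace M. \<exists>\<Omega> \<omega>. openin (mtopology_of M) \<Omega> \<and> x \<in> \<Omega> \<and>
        localizing_neighbourhood M chron causal \<tau> \<Omega> \<omega>)"

text \<open>The supremum is taken in \<^typ>\<open>ennreal\<close>, so it is \<open>0\<close> over the empty set of curves.\<close>

definition intrinsic_time_separation ::
    "'a metric \<Rightarrow> ('a \<Rightarrow> 'a \<Rightarrow> bool) \<Rightarrow> ('a \<Rightarrow> 'a \<Rightarrow> ennreal) \<Rightarrow> bool" where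
  "intrinsic_time_separation M causal \<tau> \<longleftrightarrow>
     (\<forall>x\<in>mspace M. \<forall>y\<in>mspace M.
        \<tau> x y = Sup {tau_length \<tau> a b \<gamma> |a b \<gamma>. directed_curve_from_to M causal x y a b \<gamma>})"

locale lorentzian_length_space = lorentzian_pre_length_space +
  assumes locally_causally_closed: "locally_causally_closed M causal"
    and causally_path_connected: "causally_path_connected M chron causal"
    and localizable: "localizable M chron causal \<tau>"
    and intrinsic: "intrinsic_time_separation M causal \<tau>"

section \<open>The Minkowski plane with \<open>p\<close>-time separations\<close>

text \<open>
  A point is \<open>x = (x\<^sub>0, x\<^sub>1) :: real \<times> real\<close> with time coordinate \<^term>\<open>fst x\<close>. The product metric
  of the type \<^typ>\<open>real \<times> real\<close> is the Euclidean one.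
\<close>

definition mink_chron :: "real \<times> real \<Rightarrow> real \<times> real \<Rightarrow> bool" where
  "mink_chron x y \<longleftrightarrow> fst y - fst x > \<bar>snd y - snd x\<bar>"

definition mink_causal :: "real \<times> real \<Rightarrow> real \<times> real \<Rightarrow> bool" where
  "mink_causal x y \<longleftrightarrow> fst y - fst x \<ge> \<bar>snd y - snd x\<bar>"

definition mink_tau :: "real \<Rightarrow> real \<times> real \<Rightarrow> real \<times> real \<Rightarrow> real" where
  "mink_tau p x y =
     (if fst y - fst x \<ge> \<bar>snd y - snd x\<bar>
      then (\<bar>fst y - fst x\<bar> powr p - \<bar>snd y - snd x\<bar> powr p) powr (1 / p) else 0)"

definition mink_tau_infinity :: "real \<times> real \<Rightarrow> real \<times> real \<Rightarrow> real" where
  "mink_tau_infinity x y = (if fst y - fst x > \<bar>snd y - snd x\<bar> then fst y - fst x else 0)"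

lemma mink_tau_tendsto_infinity: "((\<lambda>p. mink_tau p x y) \<longlongrightarrow> mink_tau_infinity x y) at_top"
proof (cases "fst y - fst x > \<bar>snd y - snd x\<bar>")
  case False
  then have "mink_tau p x y = 0" for p
    by (auto simp: mink_tau_def)
  with False show ?thesis by (simp add: mink_tau_infinity_def)
next
  case True
  define a b where "a = fst y - fst x" and "b = \<bar>snd y - snd x\<bar>"
  have ab: "0 \<le> b" "b < a" "0 < a" using True by (auto simp: a_def b_def)
  define r where "r = b / a"
  have r: "0 \<le> r" "r < 1" using ab by (auto simp: r_def)
  have eq: "mink_tau p x y = a * (1 - r powr p) powr (1 / p)" if "p \<ge> 1" for p
  proof -
    have "mink_tau p x y = (a powr p - b powr p) powr (1 / p)"
      using True by (simp add: mink_tau_def a_def b_def)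
    also have "a powr p - b powr p = a powr p * (1 - r powr p)"
      using ab by (simp add: r_def powr_divide algebra_simps)
    also have "(a powr p * (1 - r powr p)) powr (1 / p) = a * (1 - r powr p) powr (1 / p)"
      using ab r that powr_le1[of p r] by (simp add: powr_mult powr_powr)
    finally show ?thesis .
  qed
  have "((\<lambda>p. a * (1 - r) powr (1 / p)) \<longlongrightarrow> a * (1 - r) powr 0) at_top"
    using r by (intro tendsto_intros tendsto_divide_0[OF tendsto_const]
        filterlim_at_top_imp_at_infinity filterlim_ident) auto
  then have lower: "((\<lambda>p. a * (1 - r) powr (1 / p)) \<longlongrightarrow> a) at_top" using r by simp
  have bounds: "a * (1 - r) powr (1 / p) \<le> mink_tau p x y \<and> mink_tau p x y \<le> a"
    if p: "p \<ge> 1" for p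
  proof -
    have "r powr p \<le> r" using powr_mono'[of 1 p r] p r by simp
    then have "(1 - r) powr (1 / p) \<le> (1 - r powr p) powr (1 / p)"
      using p r by (intro powr_mono2) auto
    moreover have "(1 - r powr p) powr (1 / p) \<le> 1"
      using p r \<open>r powr p \<le> r\<close> by (intro powr_le1) auto
    ultimately show ?thesis using eq[OF p] ab by simp
  qed
  have "((\<lambda>p. mink_tau p x y) \<longlongrightarrow> a) at_top"
  proof (rule tendsto_sandwich[OF _ _ lower tendsto_const])
    show "\<forall>\<^sub>F p in at_top. a * (1 - r) powr (1 / p) \<le> mink_tau p x y"
      using eventually_ge_at_top[of 1] by eventually_elim (use bounds in blast)
    show "\<forall>\<^sub>F p in at_top. mink_tau p x y \<le> a"
      using eventually_ge_at_top[of 1] by eventually_elim (use bounds in blast)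
  qed
  then show ?thesis using True by (simp add: mink_tau_infinity_def a_def)
qed

end

theory Submission
  imports Defs
begin

text \<open>
  For \<open>x \<le> y\<close> write \<open>a = y\<^sub>0 - x\<^sub>0\<close> and \<open>b = \<bar>y\<^sub>1 - x\<^sub>1\<bar>\<close>, and let \<open>c = \<tau>\<^sup>p(x, y)\<close>. Then
  \<open>b\<^sup>p + c\<^sup>p = a\<^sup>p\<close>, so that \<open>a\<close> is the \<open>p\<close>-norm of the vector \<open>(b, c)\<close>. Minkowski's inequality for
  these vectors says that adding two causal displacements makes the time extent \<open>a\<close> at least as
  large as the norm of the sum of the vectors, and solving for the \<open>c\<close> component turns this into
  the reverse triangle inequality for \<open>\<tau>\<^sup>p\<close> (\<open>mink_tau_reverse_triangle\<close>). Clipping both differences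
  at \<open>0\<close> gives a formula for \<open>\<tau>\<^sup>p\<close> without case distinction, which shows that \<open>\<tau>\<^sup>p\<close> is continuous.
  For \<open>p = \<infinity>\<close> the function jumps across the light cone, but its superlevel sets are still
  open, because it is continuous on the open set of chronologically related pairs and \<open>0\<close> elsewhere.

  The length space axioms rest on two opposite estimates. The partition with no interior point
  bounds the \<open>\<tau>\<close>-length of any causal curve by the time separation of its endpoints
  (\<open>tau_length_le\<close>). Conversely \<open>\<tau>\<^sup>p\<close> depends only on the displacement and is positively
  homogeneous of degree one in it, so along a straight segment the sum over every partition
  telescopes to \<open>\<tau>\<^sup>p\<close> of the endpoints (\<open>tau_length_linepath\<close>). Straight segments are therefore
  maximal, which makes \<open>\<tau>\<^sup>p\<close> intrinsic; and since Euclidean balls are convex, the maximal curves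
  stay inside, so every ball is a localizing neighbourhood with \<open>\<omega> = \<tau>\<^sup>p\<close>. The Euclidean
  lengths of causal curves in a ball are bounded because time dominates space along such a curve
  (\<open>metric_length_causal_le\<close>).
\<close>

section \<open>The reverse triangle inequality\<close>

text \<open>
  Closing up the convexity of \<open>x \<mapsto> x powr p\<close> on the positive reals at the boundary point \<open>0\<close>, which
  occurs for purely temporal and for lightlike displacements. There, convexity reduces to
  \<open>w powr p \<le> w\<close> for weights \<open>w \<le> 1\<close>.
\<close>

lemma powr_convex_nonneg:
  fixes p u v x y :: real
  assumes p: "1 \<le> p" and uv: "0 \<le> u" "0 \<le> v" "u + v = 1" and xy: "0 \<le> x" "0 \<le> y"
  shows "(u * x + v * y) powr p \<le> u * x powr p + v * y powr p"
proof (cases "x = 0 \<or> y = 0")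
  case True
  have scale: "(w * z) powr p \<le> w * z powr p" if "0 \<le> w" "w \<le> 1" "0 \<le> z" for w z :: real
  proof -
    have "w powr p \<le> w"
      using powr_mono'[of 1 p w] p that by (cases "w = 0") simp_all
    then show ?thesis
      using that by (simp add: powr_mult mult_right_mono)
  qed
  show ?thesis
    using True scale[of u x] scale[of v y] uv xy p by auto
next
  case False
  have u: "u = 1 - v"
    using uv by simp
  show ?thesis
    unfolding u using convex_onD[OF powr_convex[OF p], of v x y] False uv xy by simp
qed

text \<open>
  Minkowski's inequality for the \<open>p\<close>-norm on the plane, stated with upper bounds \<open>a\<close> and \<open>a'\<close> for the
  two norms. After division by \<open>a + a'\<close> the sum of the two vectors is a convex combination
  of two vectors of norm at most \<open>1\<close>, and convexity is applied in each coordinate.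
\<close>

lemma Minkowski_powr:
  fixes p a b c a' b' c' :: real
  assumes p: "1 \<le> p"
    and nonneg: "0 \<le> a" "0 \<le> b" "0 \<le> c" "0 \<le> a'" "0 \<le> b'" "0 \<le> c'"
    and le: "b powr p + c powr p \<le> a powr p" and le': "b' powr p + c' powr p \<le> a' powr p"
  shows "(b + b') powr p + (c + c') powr p \<le> (a + a') powr p"
proof (cases "a = 0 \<or> a' = 0")
  case True
  have zero: "z = 0 \<and> w = 0" if "z powr p + w powr p \<le> 0 powr p" for z w :: real
    using that powr_ge_zero[of z p] powr_ge_zero[of w p]
    by (simp add: add_nonneg_eq_0_iff order_antisym_conv)
  from True show ?thesis
  proof
    assume "a = 0"
    with le zero[of b c] le' show ?thesis by simp
  next
    assume "a' = 0"
    with le' zero[of b' c'] le show ?thesis by simp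
  qed
next
  case False
  define s u v where "s = a + a'" and "u = a / s" and "v = a' / s"
  have pos: "0 < a" "0 < a'" "0 < s"
    using False nonneg by (auto simp: s_def)
  have uv: "0 \<le> u" "0 \<le> v" "u + v = 1"
    using pos by (simp_all add: u_def v_def s_def add_divide_distrib[symmetric])
  have mean: "((z + z') / s) powr p \<le> u * (z / a) powr p + v * (z' / a') powr p"
    if "0 \<le> z" "0 \<le> z'" for z z'
  proof -
    have "(z + z') / s = u * (z / a) + v * (z' / a')"
      using pos by (simp add: u_def v_def add_divide_distrib)
    then show ?thesis
      using powr_convex_nonneg[OF p uv, of "z / a" "z' / a'"] that pos by simp
  qed
  have unit: "(b / a) powr p + (c / a) powr p \<le> 1"
    using le nonneg pos by (simp add: powr_divide add_divide_distrib[symmetric])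
  have unit': "(b' / a') powr p + (c' / a') powr p \<le> 1"
    using le' nonneg pos by (simp add: powr_divide add_divide_distrib[symmetric])
  have "((b + b') / s) powr p + ((c + c') / s) powr p
      \<le> u * ((b / a) powr p + (c / a) powr p) + v * ((b' / a') powr p + (c' / a') powr p)"
    using mean[of b b'] mean[of c c'] nonneg by (simp add: distrib_left)
  also have "\<dots> \<le> u * 1 + v * 1"
    using unit unit' uv by (intro add_mono mult_left_mono) auto
  finally have "((b + b') / s) powr p + ((c + c') / s) powr p \<le> 1"
    using uv by simp
  then show ?thesis
    using nonneg pos by (simp add: powr_divide add_divide_distrib[symmetric] s_def)
qed

lemma mink_tau_nonneg: "0 \<le> mink_tau p x y"
  by (simp add: mink_tau_def)

text \<open>
  On the causal relation the time difference is the \<open>p\<close>-norm of the pair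
  consisting of the spatial distance and the time separation.
\<close>

lemma mink_tau_powr:
  assumes "1 \<le> p" "mink_causal x y"
  shows "\<bar>snd y - snd x\<bar> powr p + mink_tau p x y powr p = (fst y - fst x) powr p"
proof -
  have "\<bar>snd y - snd x\<bar> powr p \<le> \<bar>fst y - fst x\<bar> powr p"
    using assms by (intro powr_mono2) (auto simp: mink_causal_def)
  then show ?thesis
    using assms by (simp add: mink_tau_def mink_causal_def powr_powr)
qed

lemma mink_causal_trans: "mink_causal x y \<Longrightarrow> mink_causal y z \<Longrightarrow> mink_causal x z"
  by (auto simp: mink_causal_def)

lemma mink_tau_reverse_triangle:
  assumes p: "1 \<le> p" and xy: "mink_causal x y" and yz: "mink_causal y z"
  shows "mink_tau p x y + mink_tau p y z \<le> mink_tau p x z"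
proof -
  note xz = mink_causal_trans[OF xy yz]
  have "(\<bar>snd y - snd x\<bar> + \<bar>snd z - snd y\<bar>) powr p + (mink_tau p x y + mink_tau p y z) powr p
      \<le> ((fst y - fst x) + (fst z - fst y)) powr p"
    using p xy yz mink_tau_powr[OF p xy] mink_tau_powr[OF p yz]
    by (intro Minkowski_powr) (auto simp: mink_tau_nonneg mink_causal_def)
  \<comment> \<open>The two spatial displacements may have opposite signs, so the sum of their sizes is only an
      upper bound for the total spatial distance.\<close>
  moreover have "\<bar>snd z - snd x\<bar> powr p \<le> (\<bar>snd y - snd x\<bar> + \<bar>snd z - snd y\<bar>) powr p"
    using p by (intro powr_mono2) auto
  ultimately have "(mink_tau p x y + mink_tau p y z) powr p \<le> mink_tau p x z powr p"
    using mink_tau_powr[OF p xz] by simp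
  then show ?thesis
    using powr_less_mono2[of p "mink_tau p x z" "mink_tau p x y + mink_tau p y z"] p
    by (force simp: mink_tau_nonneg not_le[symmetric])
qed

section \<open>Pre-length structures on subsets of the plane\<close>

lemma mink_tau_pos_iff:
  assumes "1 \<le> p"
  shows "0 < mink_tau p x y \<longleftrightarrow> mink_chron x y"
proof (cases "mink_causal x y")
  case True
  have "\<bar>snd y - snd x\<bar> powr p < (fst y - fst x) powr p \<longleftrightarrow> \<bar>snd y - snd x\<bar> < fst y - fst x"
    using True assms powr_less_mono2[of p "\<bar>snd y - snd x\<bar>" "fst y - fst x"]
    by (auto simp: mink_causal_def order_le_less)
  then show ?thesis
    using mink_tau_powr[OF assms True] mink_tau_nonneg[of p x y]
    by (metis less_add_same_cancel1 less_irrefl mink_chron_def order_le_less powr_gt_zero)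
next
  case False
  then show ?thesis
    by (auto simp: mink_tau_def mink_causal_def mink_chron_def)
qed

text \<open>
  Off the causal relation the positive part of the time difference is at most the spatial
  distance, so clipping the difference of the powers at \<open>0\<close> yields exactly the default
  value \<open>0\<close>. The resulting formula is a composition of continuous functions.
\<close>

lemma continuous_on_mink_tau:
  assumes "1 \<le> p"
  shows "continuous_on UNIV (\<lambda>(x, y). mink_tau p x y)"
proof -
  have eq: "(\<lambda>(x, y). mink_tau p x y) =
      (\<lambda>(x, y). max 0 (max 0 (fst y - fst x) powr p - \<bar>snd y - snd x\<bar> powr p) powr (1 / p))"
  proof (intro ext, clarify)
    fix x y :: "real \<times> real"
    show "mink_tau p x y =
      max 0 (max 0 (fst y - fst x) powr p - \<bar>snd y - snd x\<bar> powr p) powr (1 / p)"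
    proof (cases "mink_causal x y")
      case True
      then have "max 0 (fst y - fst x) = \<bar>fst y - fst x\<bar>"
        and "\<bar>snd y - snd x\<bar> powr p \<le> \<bar>fst y - fst x\<bar> powr p"
        using assms by (auto simp: mink_causal_def intro!: powr_mono2)
      with True show ?thesis
        by (simp add: mink_tau_def mink_causal_def)
    next
      case False
      then have "max 0 (fst y - fst x) powr p \<le> \<bar>snd y - snd x\<bar> powr p"
        using assms by (intro powr_mono2) (auto simp: mink_causal_def)
      with False show ?thesis
        by (simp add: mink_tau_def mink_causal_def)
    qed
  qed
  show ?thesis
    unfolding eq unfolding case_prod_unfold using assms
    by (intro continuous_on_powr' continuous_intros) auto
qed

lemma lower_semicontinuous_ennreal:
  fixes f :: "'a::topological_space \<Rightarrow> real"
  assumes "continuous_on UNIV f"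
  shows "lower_semicontinuous_map euclidean (\<lambda>x. ennreal (f x))"
  unfolding lower_semicontinuous_map_def
  using assms by (auto intro!: open_Collect_less continuous_on_ennreal continuous_intros)

lemma lorentzian_pre_length_space_subspace:
  assumes "lorentzian_pre_length_space M chron causal \<tau>"
  shows "lorentzian_pre_length_space (submetric M S) chron causal \<tau>"
proof -
  interpret lorentzian_pre_length_space M chron causal \<tau> by fact
  have "lower_semicontinuous_map (subtopology (prod_topology (mtopology_of M) (mtopology_of M)) (S \<times> S))
      (\<lambda>(x, y). \<tau> x y)"
    unfolding lower_semicontinuous_map_def openin_subtopology
  proof
    fix c
    let ?U = "{z \<in> topspace (prod_topology (mtopology_of M) (mtopology_of M)). c < (\<lambda>(x, y). \<tau> x y) z}"
    have "openin (prod_topology (mtopology_of M) (mtopology_of M)) ?U"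
      using tau_lsc by (simp only: lower_semicontinuous_map_def)
    then show "\<exists>T. openin (prod_topology (mtopology_of M) (mtopology_of M)) T \<and>
        {z \<in> topspace (subtopology (prod_topology (mtopology_of M) (mtopology_of M)) (S \<times> S)).
          c < (\<lambda>(x, y). \<tau> x y) z} = T \<inter> S \<times> S"
      by (intro exI[of _ ?U] conjI) (auto simp only: topspace_subtopology Int_iff mem_Collect_eq)
  qed
  then have lsc: "lower_semicontinuous_map
      (prod_topology (mtopology_of (submetric M S)) (mtopology_of (submetric M S))) (\<lambda>(x, y). \<tau> x y)"
    by (simp only: mtopology_of_submetric subtopology_Times)
  show ?thesis
    by (intro lorentzian_pre_length_space.intro lsc)
      (auto intro: causal_refl causal_trans chron_trans chron_imp_causal
        tau_reverse_triangle tau_eq_0 simp only: mspace_submetric Int_iff tau_pos_iff)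
qed

lemma mink_pre_length_space:
  assumes p: "1 \<le> p"
  shows "lorentzian_pre_length_space (euclidean_metric :: (real \<times> real) metric)
    mink_chron mink_causal (\<lambda>x y. ennreal (mink_tau p x y))"
proof
  show "lower_semicontinuous_map
      (prod_topology (mtopology_of (euclidean_metric :: (real \<times> real) metric))
        (mtopology_of euclidean_metric)) (\<lambda>(x, y). ennreal (mink_tau p x y))"
    using lower_semicontinuous_ennreal[OF continuous_on_mink_tau[OF p]]
    by (simp add: case_prod_unfold)
next
  fix x y z :: "real \<times> real"
  assume "mink_causal x y" "mink_causal y z"
  then show "ennreal (mink_tau p x y) + ennreal (mink_tau p y z) \<le> ennreal (mink_tau p x z)"
    using mink_tau_reverse_triangle[OF p]
    by (simp add: ennreal_plus[symmetric] mink_tau_nonneg ennreal_leI del: ennreal_plus)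
next
  fix x y :: "real \<times> real"
  show "0 < ennreal (mink_tau p x y) \<longleftrightarrow> mink_chron x y"
    using mink_tau_pos_iff[OF p] by simp
qed (auto simp: mink_causal_def mink_chron_def mink_tau_def)

text \<open>
  Lower semicontinuity holds because a superlevel set of \<open>\<tau>\<^sup>\<infinity>\<close> is the intersection of two open sets:
  the chronological relation and a superlevel set of the time difference. The reverse triangle
  inequality holds because a chain of two causal steps is chronological as soon as one
  of them is.
\<close>

lemma mink_infinity_pre_length_space:
  "lorentzian_pre_length_space (euclidean_metric :: (real \<times> real) metric)
    mink_chron mink_causal (\<lambda>x y. ennreal (mink_tau_infinity x y))"
proof
  have "{z. c < ennreal (mink_tau_infinity (fst z) (snd z))} =
      {z. \<bar>snd (snd z) - snd (fst z)\<bar> < fst (snd z) - fst (fst z)}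
      \<inter> {z. c < ennreal (fst (snd z) - fst (fst z))}" for c
    by (auto simp: mink_tau_infinity_def)
  then have "open {z. c < ennreal (mink_tau_infinity (fst z) (snd z))}" for c
    by (simp only:) (intro open_Int open_Collect_less continuous_on_ennreal continuous_intros)
  then show "lower_semicontinuous_map
      (prod_topology (mtopology_of (euclidean_metric :: (real \<times> real) metric))
        (mtopology_of euclidean_metric)) (\<lambda>(x, y). ennreal (mink_tau_infinity x y))"
    by (simp add: lower_semicontinuous_map_def case_prod_unfold)
next
  fix x y z :: "real \<times> real"
  assume "mink_causal x y" "mink_causal y z"
  then show "ennreal (mink_tau_infinity x y) + ennreal (mink_tau_infinity y z)
      \<le> ennreal (mink_tau_infinity x z)"
    by (auto simp: mink_tau_infinity_def mink_causal_def ennreal_plus[symmetric] ennreal_leI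
        simp del: ennreal_plus)
qed (auto simp: mink_causal_def mink_chron_def mink_tau_infinity_def)

section \<open>Partitions and curves\<close>

text \<open>
  On an empty or one-point interval every map is constant.
\<close>

lemma directed_curve_less: "directed_curve M R a b \<gamma> \<Longrightarrow> a < b"
  by (rule ccontr) (auto simp: directed_curve_def constant_on_def not_less order_le_less)

lemma partitions_mono:
  assumes "(n, t) \<in> partitions a b" "i \<le> j" "j \<le> n"
  shows "t i \<le> t j"
  using assms(2,3)
proof (induction j rule: dec_induct)
  case (step m)
  have "t m < t (Suc m)"
    using assms(1) step.prems by (simp add: partitions_def)
  then show ?case
    using step by simp
qed simp

lemma partitions_in_interval:
  assumes "(n, t) \<in> partitions a b" "i \<le> n"
  shows "t i \<in> {a..b}"
  using partitions_mono[OF assms(1), of 0 i] partitions_mono[OF assms(1), of i n] assms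
  by (auto simp: partitions_def)

lemma tau_length_le_endpoints:
  assumes "a < b"
  shows "tau_length \<tau> a b \<gamma> \<le> \<tau> (\<gamma> a) (\<gamma> b)"
proof -
  define t where "t i = (if i = 0 then a else b)" for i :: nat
  have "(1, t) \<in> partitions a b"
    using assms by (simp add: partitions_def t_def)
  then have "tau_length \<tau> a b \<gamma> \<le> (\<Sum>i<1. \<tau> (\<gamma> (t i)) (\<gamma> (t (Suc i))))"
    unfolding tau_length_def by (intro INF_lower2[of "(1, t)"]) auto
  then show ?thesis
    by (simp add: t_def)
qed

lemma tau_length_le:
  assumes "directed_curve_from_to M R x y a b \<gamma>"
  shows "tau_length \<tau> a b \<gamma> \<le> \<tau> x y"
  using assms tau_length_le_endpoints[of a b \<tau> \<gamma>] directed_curve_less[of M R a b \<gamma>]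
  by (auto simp: directed_curve_from_to_def)

text \<open>
  For causally related points the spatial distance is at most the time difference, so the Euclidean
  distance is at most twice the latter; time differences telescope along a partition.
\<close>

lemma metric_length_causal_le:
  assumes "directed_curve euclidean_metric mink_causal a b \<gamma>"
  shows "metric_length euclidean_metric a b \<gamma> \<le> ennreal (2 * (fst (\<gamma> b) - fst (\<gamma> a)))"
  unfolding metric_length_def
proof (rule SUP_least, clarify)
  fix n t assume nt: "(n, t) \<in> partitions a b"
  have causal: "mink_causal (\<gamma> (t i)) (\<gamma> (t (Suc i)))" if "i < n" for i
    using assms nt that partitions_in_interval[OF nt, of i] partitions_in_interval[OF nt, of "Suc i"]
    by (auto simp: directed_curve_def partitions_def)
  have step: "dist u v \<le> 2 * fst v - 2 * fst u" if "mink_causal u v" for u v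
    using that norm_Pair_le[of "fst u - fst v" "snd u - snd v"]
    by (auto simp: mink_causal_def dist_norm minus_prod_def)
  have "(\<Sum>i<n. ennreal (mdist euclidean_metric (\<gamma> (t i)) (\<gamma> (t (Suc i)))))
      = ennreal (\<Sum>i<n. dist (\<gamma> (t i)) (\<gamma> (t (Suc i))))"
    by simp
  also have "\<dots> \<le> ennreal (\<Sum>i<n. 2 * fst (\<gamma> (t (Suc i))) - 2 * fst (\<gamma> (t i)))"
    using causal step by (intro ennreal_leI sum_mono) auto
  also have "\<dots> = ennreal (2 * (fst (\<gamma> b) - fst (\<gamma> a)))"
    using nt by (subst sum_lessThan_telescope) (auto simp: partitions_def)
  finally show "(\<Sum>i<n. ennreal (mdist euclidean_metric (\<gamma> (t i)) (\<gamma> (t (Suc i)))))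
      \<le> ennreal (2 * (fst (\<gamma> b) - fst (\<gamma> a)))" .
qed

section \<open>Straight segments\<close>

lemma linepath_diff: "linepath x y t - linepath x y s = (t - s) *\<^sub>R (y - x)"
  by (simp add: linepath_def algebra_simps)

lemma fst_linepath_diff:
  "fst (linepath x y t) - fst (linepath x y s) = (t - s) * (fst y - fst x)"
  and snd_linepath_diff:
  "snd (linepath x y t) - snd (linepath x y s) = (t - s) * (snd y - snd x)"
  for x y :: "real \<times> real"
  using linepath_diff[of x y t s] by (simp_all flip: fst_diff snd_diff)

lemma mink_causal_linepath:
  assumes "mink_causal x y" "s \<le> t"
  shows "mink_causal (linepath x y s) (linepath x y t)"
  using assms by (simp add: mink_causal_def fst_linepath_diff snd_linepath_diff abs_mult mult_left_mono)

lemma mink_chron_linepath: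
  assumes "mink_chron x y" "s < t"
  shows "mink_chron (linepath x y s) (linepath x y t)"
  using assms by (simp add: mink_chron_def fst_linepath_diff snd_linepath_diff abs_mult)

lemma directed_curve_linepath:
  fixes x y :: "'a::real_normed_vector"
  assumes "x \<noteq> y" and R: "\<And>s t. s < t \<Longrightarrow> R (linepath x y s) (linepath x y t)"
  shows "directed_curve_from_to euclidean_metric R x y 0 1 (linepath x y)"
proof -
  have "dist (linepath x y s) (linepath x y t) \<le> norm (y - x) * dist s t" for s t
    by (simp add: dist_norm linepath_diff dist_real_def mult.commute)
  then have "Lipschitz_continuous_map (submetric euclidean_metric {0..1}) euclidean_metric (linepath x y)"
    unfolding Lipschitz_continuous_map_def by auto
  then have "locally_Lipschitz_curve euclidean_metric 0 1 (linepath x y)"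
    unfolding locally_Lipschitz_curve_def by (intro ballI exI[of _ "{0..1}"]) auto
  moreover have "\<not> linepath x y constant_on {0..1}"
  proof
    assume "linepath x y constant_on {0..1}"
    then have "linepath x y 0 = linepath x y 1"
      by (auto simp: constant_on_def)
    with \<open>x \<noteq> y\<close> show False by (simp add: linepath_0' linepath_1')
  qed
  ultimately show ?thesis
    using R by (simp add: directed_curve_from_to_def directed_curve_def linepath_0' linepath_1')
qed

text \<open>
  Translation invariance and positive homogeneity of \<open>\<tau>\<^sup>p\<close>, in the form in which they are used on
  segments.
\<close>

lemma mink_tau_linepath:
  assumes p: "1 \<le> p" and xy: "mink_causal x y" and "s \<le> t"
  shows "mink_tau p (linepath x y s) (linepath x y t) = (t - s) * mink_tau p x y"
proof -
  have "\<bar>snd y - snd x\<bar> powr p \<le> \<bar>fst y - fst x\<bar> powr p"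
    using assms by (intro powr_mono2) (auto simp: mink_causal_def)
  moreover have "\<bar>(t - s) * w\<bar> powr p = (t - s) powr p * \<bar>w\<bar> powr p" for w
    using \<open>s \<le> t\<close> by (simp add: abs_mult powr_mult)
  then have "\<bar>(t - s) * (fst y - fst x)\<bar> powr p - \<bar>(t - s) * (snd y - snd x)\<bar> powr p
      = (t - s) powr p * (\<bar>fst y - fst x\<bar> powr p - \<bar>snd y - snd x\<bar> powr p)"
    by (simp only: right_diff_distrib[of "(t - s) powr p"])
  ultimately show ?thesis
    using assms mink_causal_linepath[OF xy \<open>s \<le> t\<close>]
    by (simp add: mink_tau_def mink_causal_def fst_linepath_diff snd_linepath_diff
        powr_mult powr_powr)
qed

lemma tau_length_linepath:
  assumes p: "1 \<le> p" and xy: "mink_causal x y"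
  shows "tau_length (\<lambda>x y. ennreal (mink_tau p x y)) 0 1 (linepath x y) = ennreal (mink_tau p x y)"
proof (rule antisym)
  show "tau_length (\<lambda>x y. ennreal (mink_tau p x y)) 0 1 (linepath x y) \<le> ennreal (mink_tau p x y)"
    using tau_length_le_endpoints[of 0 1 _ "linepath x y"] by (simp add: linepath_0' linepath_1')
  show "ennreal (mink_tau p x y) \<le> tau_length (\<lambda>x y. ennreal (mink_tau p x y)) 0 1 (linepath x y)"
    unfolding tau_length_def
  proof (rule INF_greatest, clarify)
    fix n t assume nt: "(n, t) \<in> partitions 0 (1::real)"
    have "(\<Sum>i<n. ennreal (mink_tau p (linepath x y (t i)) (linepath x y (t (Suc i)))))
        = ennreal (\<Sum>i<n. mink_tau p (linepath x y (t i)) (linepath x y (t (Suc i))))"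
      by (simp add: mink_tau_nonneg)
    also have "(\<Sum>i<n. mink_tau p (linepath x y (t i)) (linepath x y (t (Suc i))))
        = (\<Sum>i<n. t (Suc i) - t i) * mink_tau p x y"
      unfolding sum_distrib_right using nt
      by (intro sum.cong refl mink_tau_linepath[OF p xy]) (auto simp: partitions_def less_imp_le)
    also have "(\<Sum>i<n. t (Suc i) - t i) = 1"
      using nt by (subst sum_lessThan_telescope) (simp add: partitions_def)
    finally show "ennreal (mink_tau p x y)
        \<le> (\<Sum>i<n. ennreal (mink_tau p (linepath x y (t i)) (linepath x y (t (Suc i)))))"
      by simp
  qed
qed

section \<open>The length space axioms\<close>

text \<open>
  The causal relation is given by a non-strict inequality between continuous functions, so it is
  closed globally and the whole plane can serve as the neighbourhood.
\<close>

lemma mink_locally_causally_closed: "locally_causally_closed euclidean_metric mink_causal"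
proof -
  have "mink_causal a b"
    if "\<And>n. mink_causal (f n) (g n)" "f \<longlonglongrightarrow> a" "g \<longlonglongrightarrow> b" for f g :: "nat \<Rightarrow> real \<times> real" and a b
    unfolding mink_causal_def
  proof (rule tendsto_le)
    show "(\<lambda>n. fst (g n) - fst (f n)) \<longlonglongrightarrow> fst b - fst a"
      "(\<lambda>n. \<bar>snd (g n) - snd (f n)\<bar>) \<longlonglongrightarrow> \<bar>snd b - snd a\<bar>"
      using that by (auto intro!: tendsto_intros)
  qed (use that in \<open>auto simp: mink_causal_def\<close>)
  then show ?thesis
    unfolding locally_causally_closed_def
    by (intro ballI exI[of _ UNIV] conjI allI impI) (simp_all, blast)
qed

lemma mink_causally_path_connected:
  "causally_path_connected euclidean_metric mink_chron mink_causal"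
  unfolding causally_path_connected_def
proof (intro ballI conjI impI exI)
  fix x y :: "real \<times> real"
  show "directed_curve_from_to euclidean_metric mink_chron x y 0 1 (linepath x y)"
    if "mink_chron x y"
    using that by (intro directed_curve_linepath mink_chron_linepath) (auto simp: mink_chron_def)
  show "directed_curve_from_to euclidean_metric mink_causal x y 0 1 (linepath x y)"
    if "mink_causal x y \<and> x \<noteq> y"
    using that by (intro directed_curve_linepath mink_causal_linepath) auto
qed

text \<open>
  Where \<open>\<tau>\<^sup>p\<close> is positive, the straight segment attains the supremum. Everywhere else it is enough
  that all lengths are bounded by \<open>\<tau>\<^sup>p = 0\<close>, whether or not there is a causal curve.
\<close>

lemma mink_intrinsic:
  assumes p: "1 \<le> p"
  shows "intrinsic_time_separation euclidean_metric mink_causal (\<lambda>x y. ennreal (mink_tau p x y))"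
  unfolding intrinsic_time_separation_def
proof (intro ballI)
  fix x y :: "real \<times> real"
  let ?\<tau> = "\<lambda>x y. ennreal (mink_tau p x y)"
  let ?L = "{tau_length ?\<tau> a b \<gamma> |a b \<gamma>.
    directed_curve_from_to euclidean_metric mink_causal x y a b \<gamma>}"
  have "Sup ?L \<le> ?\<tau> x y"
    by (intro Sup_least) (auto dest: tau_length_le[where \<tau> = ?\<tau>])
  moreover have "?\<tau> x y \<le> Sup ?L"
  proof (cases "mink_chron x y")
    case True
    then have "mink_causal x y" "x \<noteq> y"
      by (auto simp: mink_chron_def mink_causal_def)
    then have "directed_curve_from_to euclidean_metric mink_causal x y 0 1 (linepath x y)"
      by (intro directed_curve_linepath mink_causal_linepath) auto
    then have "tau_length ?\<tau> 0 1 (linepath x y) \<in> ?L"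
      by blast
    then show ?thesis
      using tau_length_linepath[OF p \<open>mink_causal x y\<close>] by (metis (lifting) Sup_upper)
  next
    case False
    then have "mink_tau p x y = 0"
      using mink_tau_pos_iff[OF p, of x y] mink_tau_nonneg[of p x y] by simp
    then show ?thesis by simp
  qed
  ultimately show "?\<tau> x y = Sup ?L"
    by simp
qed

text \<open>
  A ball is bounded, which limits the lengths of causal curves; open, which leaves room for a point
  in the future and in the past of each of its points; and convex, so that it contains the maximal
  curve, the segment, between any two of its points.
\<close>

lemma mink_ball_localizing:
  assumes p: "1 \<le> p" and r: "0 < r"
  shows "localizing_neighbourhood euclidean_metric mink_chron mink_causal
    (\<lambda>x y. ennreal (mink_tau p x y)) (ball c r) (mink_tau p)"
  unfolding localizing_neighbourhood_def
proof (intro conjI ballI impI)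
  show "\<exists>C>0. \<forall>a b \<gamma>. directed_curve euclidean_metric mink_causal a b \<gamma> \<and> \<gamma> ` {a..b} \<subseteq> ball c r
      \<longrightarrow> metric_length euclidean_metric a b \<gamma> \<le> ennreal C"
  \<comment> \<open>Times in the ball differ by at most its diameter \<open>2 * r\<close>, and a causal curve is at most
      twice as long as the time that passes along it.\<close>
  proof (intro exI[of _ "4 * r"] conjI allI impI)
    fix a b \<gamma>
    assume \<gamma>: "directed_curve euclidean_metric mink_causal a b \<gamma> \<and> \<gamma> ` {a..b} \<subseteq> ball c r"
    then have "a < b" by (auto intro: directed_curve_less)
    with \<gamma> have "\<gamma> a \<in> ball c r" "\<gamma> b \<in> ball c r"
      by (auto simp: image_subset_iff)
    then have "dist (\<gamma> a) (\<gamma> b) < 2 * r"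
      using dist_triangle2[of "\<gamma> a" "\<gamma> b" c] by (simp add: dist_commute)
    then have "2 * (fst (\<gamma> b) - fst (\<gamma> a)) \<le> 4 * r"
      using dist_fst_le[of "\<gamma> a" "\<gamma> b"] by (simp add: dist_real_def)
    then show "metric_length euclidean_metric a b \<gamma> \<le> ennreal (4 * r)"
      using metric_length_causal_le[of a b \<gamma>] \<gamma> by (meson ennreal_leI order_trans)
  qed (use r in simp)
next
  show "0 \<le> mink_tau p x y" for x y
    by (rule mink_tau_nonneg)
next
  show "continuous_map
      (prod_topology (mtopology_of (submetric euclidean_metric (ball c r)))
        (mtopology_of (submetric euclidean_metric (ball c r))))
      euclideanreal (\<lambda>(x, y). mink_tau p x y)"
    using continuous_on_subset[OF continuous_on_mink_tau[OF p] subset_UNIV]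
    by (simp add: mtopology_of_submetric subtopology_Times[symmetric])
next
  show "lorentzian_pre_length_space (submetric euclidean_metric (ball c r)) mink_chron mink_causal
      (\<lambda>x y. ennreal (mink_tau p x y))"
    by (intro lorentzian_pre_length_space_subspace mink_pre_length_space p)
next
  fix y assume "y \<in> ball c r"
  then obtain e where e: "0 < e" "ball y e \<subseteq> ball c r"
    using open_contains_ball open_ball by blast
  have "y + (e / 2, 0) \<in> {z \<in> mspace euclidean_metric. mink_chron y z} \<inter> ball c r"
    using e subsetD[OF e(2), of "y + (e / 2, 0)"] by (simp add: mink_chron_def dist_norm norm_Pair)
  then show "{z \<in> mspace euclidean_metric. mink_chron y z} \<inter> ball c r \<noteq> {}"
    by blast
  have "y - (e / 2, 0) \<in> {z \<in> mspace euclidean_metric. mink_chron z y} \<inter> ball c r"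
    using e subsetD[OF e(2), of "y - (e / 2, 0)"] by (simp add: mink_chron_def dist_norm norm_Pair)
  then show "{z \<in> mspace euclidean_metric. mink_chron z y} \<inter> ball c r \<noteq> {}"
    by blast
next
  fix x y assume x: "x \<in> ball c r" and y: "y \<in> ball c r" and xy: "mink_causal x y \<and> x \<noteq> y"
  let ?\<tau> = "\<lambda>x y. ennreal (mink_tau p x y)"
  have "directed_curve_from_to euclidean_metric mink_causal x y 0 1 (linepath x y)"
    using xy by (intro directed_curve_linepath mink_causal_linepath) auto
  moreover have "linepath x y ` {0..1} \<subseteq> ball c r"
    using x y by (simp add: linepath_image_01 closed_segment_subset)
  ultimately show "\<exists>a b \<gamma>. directed_curve_from_to euclidean_metric mink_causal x y a b \<gamma> \<and>
      \<gamma> ` {a..b} \<subseteq> ball c r \<and>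
      (\<forall>a' b' \<sigma>. directed_curve_from_to euclidean_metric mink_causal x y a' b' \<sigma> \<and>
         \<sigma> ` {a'..b'} \<subseteq> ball c r \<longrightarrow> tau_length ?\<tau> a' b' \<sigma> \<le> tau_length ?\<tau> a b \<gamma>) \<and>
      tau_length ?\<tau> a b \<gamma> = ?\<tau> x y \<and> ?\<tau> x y \<le> ?\<tau> x y"
    using xy tau_length_linepath[OF p, of x y]
    by (intro exI[of _ 0] exI[of _ 1] exI[of _ "linepath x y"])
      (auto dest: tau_length_le[where \<tau> = ?\<tau>])
qed

lemma mink_localizable:
  assumes "1 \<le> p"
  shows "localizable euclidean_metric mink_chron mink_causal (\<lambda>x y. ennreal (mink_tau p x y))"
  unfolding localizable_def
proof (intro ballI)
  fix x :: "real \<times> real"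
  show "\<exists>\<Omega> \<omega>. openin (mtopology_of euclidean_metric) \<Omega> \<and> x \<in> \<Omega> \<and>
      localizing_neighbourhood euclidean_metric mink_chron mink_causal
        (\<lambda>x y. ennreal (mink_tau p x y)) \<Omega> \<omega>"
    using mink_ball_localizing[OF assms zero_less_one, of x]
    by (intro exI[of _ "ball x 1"] exI[of _ "mink_tau p"]) (simp add: case_prod_unfold)
qed

theorem lemma3p3:
  shows "(\<forall>p::real. 1 \<le> p \<longrightarrow>
            lorentzian_length_space (euclidean_metric :: (real \<times> real) metric)
              mink_chron mink_causal (\<lambda>x y. ennreal (mink_tau p x y))) \<and>
         lorentzian_pre_length_space (euclidean_metric :: (real \<times> real) metric)
           mink_chron mink_causal (\<lambda>x y. ennreal (mink_tau_infinity x y))"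
  by (auto simp: lorentzian_length_space_def lorentzian_length_space_axioms_def
      mink_pre_length_space mink_infinity_pre_length_space mink_locally_causally_closed
      mink_causally_path_connected mink_localizable mink_intrinsic)

end
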